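(* Let $A\in\mathbb{R}^{n_x\times n_x}$, $B\in\mathbb{R}^{n_x\times n_u}$ with $(A,B)$ controllable, let $Q\in\mathbb{R}^{n_x\times n_x}$ and $R\in\mathbb{R}^{n_u\times n_u}$ be symmetric positive definite, and let $0<\gamma\le 1$. Let $\pi(x)=-K^\pi x$, with $K^\pi\in\mathbb{R}^{n_u\times n_x}$, be a stabilizing policy for $x_{k+1}=Ax_k+Bu_k$, and let $H^\pi$ be the symmetric matrix representing the Q-function $Q^\pi$ of $\pi$, partitioned as $$H^\pi=\begin{bmatrix} H^\pi_{xx} & H^\pi_{xu}\\ (H^\pi_{xu})^T & H^\pi_{uu}\end{bmatrix},\qquad H^\pi_{xx}\in\mathbb{R}^{n_x\times n_x},\ H^\pi_{xu}\in\mathbb{R}^{n_x\times n_u},\ H^\pi_{uu}\in\mathbb{R}^{n_u\times n_u}.$$ Then the policy improvement $\pi'(x_k)=\arg\min_{u_k\in\mathbb{R}^{n_u}}Q^\pi(x_k,u_k)$ of $\pi$ is given, for every $x_k\in\mathbb{R}^{n_x}$, by $$\pi'(x_k)=-(H^\pi_{uu})^{-1}(H^\pi_{xu})^Tx_k .$$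
   Context: The system is the discrete-time linear system $x_{k+1}=Ax_k+Bu_k$ with state $x_k\in\mathbb{R}^{n_x}$ and input $u_k\in\mathbb{R}^{n_u}$. A policy is a linear state feedback $u_k=\pi(x_k)=-K^\pi x_k$. It is stabilizing if every closed-loop trajectory $x_{k+1}=(A-BK^\pi)x_k$ converges to $0$. The local cost is $c(x,u)=x^TQx+u^TRu$. The value function of $\pi$ is $V^\pi(x_k)=\sum_{i=k}^{\infty}\gamma^{i-k}\left(x_i^TQx_i+u_i^TRu_i\right)$, where $u_i=\pi(x_i)$ and $x_{i+1}=Ax_i+Bu_i$ for $i\ge k$. The Q-function of $\pi$ is $Q^\pi(x,u)=c(x,u)+\gamma V^\pi(Ax+Bu)$ for all $x\in\mathbb{R}^{n_x}$, $u\in\mathbb{R}^{n_u}$ ($u$ arbitrary at the first step, $\pi$ followed afterwards). For a stabilizing policy $\pi$, $Q^\pi$ is a quadratic form, and $H^\pi\in\mathbb{R}^{(n_x+n_u)\times(n_x+n_u)}$ denotes the symmetric matrix with $Q^\pi(x,u)=\begin{bmatrix} x\\ u\end{bmatrix}^T H^\pi\begin{bmatrix} x\\ u\end{bmatrix}$ for all $x,u$. *)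

theory Defs
  imports "HOL-Analysis.Analysis"
begin

definition sym_pos_def :: "real^'n^'n \<Rightarrow> bool" where
  "sym_pos_def M \<longleftrightarrow> transpose M = M \<and> (\<forall>x. x \<noteq> 0 \<longrightarrow> x \<bullet> (M *v x) > 0)"

primrec open_loop :: "real^'n^'n \<Rightarrow> real^'m^'n \<Rightarrow> (nat \<Rightarrow> real^'m) \<Rightarrow> real^'n \<Rightarrow> nat \<Rightarrow> real^'n" where
  "open_loop A B u x0 0 = x0"
| "open_loop A B u x0 (Suc k) = A *v open_loop A B u x0 k + B *v u k"

text \<open>Controllability as state transfer: any state can be steered to any other state in finitely
  many steps. (For discrete time this is the notion expressed by the Kalman rank condition, and is
  stronger than steering every state to the origin.)\<close>

definition controllable :: "real^'n^'n \<Rightarrow> real^'m^'n \<Rightarrow> bool" where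
  "controllable A B \<longleftrightarrow> (\<forall>x0 x1. \<exists>N u. open_loop A B u x0 N = x1)"

definition linear_policy :: "real^'n^'m \<Rightarrow> real^'n \<Rightarrow> real^'m" where
  "linear_policy K x = - (K *v x)"

definition stabilizing :: "real^'n^'n \<Rightarrow> real^'m^'n \<Rightarrow> real^'n^'m \<Rightarrow> bool" where
  "stabilizing A B K \<longleftrightarrow>
     (\<forall>x :: nat \<Rightarrow> real^'n. (\<forall>k. x (Suc k) = (A - B ** K) *v x k) \<longrightarrow> x \<longlonglongrightarrow> 0)"

definition local_cost :: "real^'n^'n \<Rightarrow> real^'m^'m \<Rightarrow> real^'n \<Rightarrow> real^'m \<Rightarrow> real" where
  "local_cost Q R x u = x \<bullet> (Q *v x) + u \<bullet> (R *v u)"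

primrec closed_loop ::
  "real^'n^'n \<Rightarrow> real^'m^'n \<Rightarrow> (real^'n \<Rightarrow> real^'m) \<Rightarrow> real^'n \<Rightarrow> nat \<Rightarrow> real^'n" where
  "closed_loop A B \<pi> x0 0 = x0"
| "closed_loop A B \<pi> x0 (Suc k) =
     A *v closed_loop A B \<pi> x0 k + B *v \<pi> (closed_loop A B \<pi> x0 k)"

text \<open>The system is time invariant, so the cost-to-go from time \<open>k\<close> is indexed by \<open>i - k\<close>.\<close>

definition value_fun ::
  "real^'n^'n \<Rightarrow> real^'m^'n \<Rightarrow> real^'n^'n \<Rightarrow> real^'m^'m \<Rightarrow> real \<Rightarrow> (real^'n \<Rightarrow> real^'m)
     \<Rightarrow> real^'n \<Rightarrow> real" where
  "value_fun A B Q R \<gamma> \<pi> x =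
     (\<Sum>i. \<gamma> ^ i * local_cost Q R (closed_loop A B \<pi> x i) (\<pi> (closed_loop A B \<pi> x i)))"

definition q_fun ::
  "real^'n^'n \<Rightarrow> real^'m^'n \<Rightarrow> real^'n^'n \<Rightarrow> real^'m^'m \<Rightarrow> real \<Rightarrow> (real^'n \<Rightarrow> real^'m)
     \<Rightarrow> real^'n \<Rightarrow> real^'m \<Rightarrow> real" where
  "q_fun A B Q R \<gamma> \<pi> x u =
     local_cost Q R x u + \<gamma> * value_fun A B Q R \<gamma> \<pi> (A *v x + B *v u)"

definition stack :: "real^'n \<Rightarrow> real^'m \<Rightarrow> real^('n + 'm)" where
  "stack x u = (\<chi> i. case i of Inl a \<Rightarrow> x $ a | Inr b \<Rightarrow> u $ b)"

definition q_matrix ::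
  "real^'n^'n \<Rightarrow> real^'m^'n \<Rightarrow> real^'n^'n \<Rightarrow> real^'m^'m \<Rightarrow> real \<Rightarrow> (real^'n \<Rightarrow> real^'m)
     \<Rightarrow> real^('n + 'm)^('n + 'm)" where
  "q_matrix A B Q R \<gamma> \<pi> =
     (THE H. transpose H = H \<and>
        (\<forall>x u. q_fun A B Q R \<gamma> \<pi> x u = stack x u \<bullet> (H *v stack x u)))"

definition block_xu :: "real^('n::finite + 'm::finite)^('n + 'm) \<Rightarrow> real^'m^'n" where
  "block_xu H = (\<chi> i j. H $ Inl i $ Inr j)"

definition block_uu :: "real^('n::finite + 'm::finite)^('n + 'm) \<Rightarrow> real^'m^'m" where
  "block_uu H = (\<chi> i j. H $ Inr i $ Inr j)"

definition is_policy_improvement ::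
  "real^'n^'n \<Rightarrow> real^'m^'n \<Rightarrow> real^'n^'n \<Rightarrow> real^'m^'m \<Rightarrow> real \<Rightarrow> (real^'n \<Rightarrow> real^'m)
     \<Rightarrow> (real^'n \<Rightarrow> real^'m) \<Rightarrow> bool" where
  "is_policy_improvement A B Q R \<gamma> \<pi> \<pi>' \<longleftrightarrow>
     (\<forall>x. is_arg_min (q_fun A B Q R \<gamma> \<pi> x) (\<lambda>_. True) (\<pi>' x))"

end

theory Submission
  imports Defs
begin

text \<open>Since every closed-loop trajectory tends to \<open>0\<close> and the state space is finite-dimensional, some
  power of the closed-loop map halves all norms. Trajectories are therefore absolutely summable, so
  the value function is a nonnegative quadratic form even for \<open>\<gamma> = 1\<close>. Hence \<open>H\<close> exists and is
  unique, its input block is positive definite because \<open>R\<close> is, and completing the square in \<open>u\<close>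
  exhibits the unique minimiser.\<close>

section \<open>Linear maps with vanishing orbits\<close>

lemma linear_funpow:
  fixes f :: "'a::real_vector \<Rightarrow> 'a"
  assumes "linear f"
  shows "linear (f ^^ k)"
proof (induction k)
  case 0
  then show ?case by (simp add: linear_iff)
next
  case (Suc k)
  then show ?case using linear_compose[OF Suc assms] by (simp only: funpow.simps)
qed

text \<open>Pointwise convergence becomes uniform because only the finitely many basis vectors
  matter. Expanding \<open>x\<close> in the basis and using that each coordinate is at most
  \<open>norm x\<close> bounds the operator norm of \<open>f ^^ N\<close> by the sum of the norms of
  the basis images.\<close>

lemma vanishing_orbits_contraction:
  fixes f :: "'a::euclidean_space \<Rightarrow> 'a"
  assumes "linear f" and vanish: "\<And>x. (\<lambda>k. (f ^^ k) x) \<longlonglongrightarrow> 0"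
  obtains N where "\<And>x. norm ((f ^^ N) x) \<le> norm x / 2"
proof -
  have "(\<lambda>k. \<Sum>b\<in>Basis. norm ((f ^^ k) b)) \<longlonglongrightarrow> (\<Sum>b\<in>(Basis::'a set). 0)"
    by (intro tendsto_sum tendsto_norm_zero vanish)
  then have "\<forall>\<^sub>F k in sequentially. (\<Sum>b\<in>Basis. norm ((f ^^ k) b)) < 1/2"
    by (intro order_tendstoD(2)) auto
  then obtain N where N: "(\<Sum>b\<in>Basis. norm ((f ^^ N) b)) < 1/2"
    by (auto simp: eventually_sequentially)
  have "norm ((f ^^ N) x) \<le> norm x / 2" for x
  proof -
    have lin: "linear (f ^^ N)"
      by (rule linear_funpow[OF assms(1)])
    have "(f ^^ N) x = (f ^^ N) (\<Sum>b\<in>Basis. (x \<bullet> b) *\<^sub>R b)"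
      by (simp add: euclidean_representation)
    also have "\<dots> = (\<Sum>b\<in>Basis. (x \<bullet> b) *\<^sub>R (f ^^ N) b)"
      by (simp add: linear_sum[OF lin] linear_scale[OF lin])
    finally have "norm ((f ^^ N) x) \<le> (\<Sum>b\<in>Basis. \<bar>x \<bullet> b\<bar> * norm ((f ^^ N) b))"
      by (simp add: sum_norm_le)
    also have "\<dots> \<le> (\<Sum>b\<in>Basis. norm x * norm ((f ^^ N) b))"
      by (intro sum_mono mult_right_mono) (auto simp: Basis_le_norm)
    also have "\<dots> = norm x * (\<Sum>b\<in>Basis. norm ((f ^^ N) b))"
      by (simp add: sum_distrib_left)
    also have "\<dots> \<le> norm x * (1/2)"
      using N by (intro mult_left_mono) auto
    finally show ?thesis by simp
  qed
  then show thesis by (rule that)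
qed

text \<open>Each term shifted by \<open>N\<close> is at most half the original, so the partial sums
  satisfy S_n \<le> S_N + S_n / 2. Solving for S_n gives a bound independent of
  \<open>n\<close>.\<close>

lemma summable_norm_vanishing_orbit:
  fixes f :: "'a::euclidean_space \<Rightarrow> 'a"
  assumes "linear f" and "\<And>x. (\<lambda>k. (f ^^ k) x) \<longlonglongrightarrow> 0"
  shows "summable (\<lambda>k. norm ((f ^^ k) x))"
proof -
  obtain N where N: "\<And>x. norm ((f ^^ N) x) \<le> norm x / 2"
    using vanishing_orbits_contraction[OF assms] by blast
  define a where "a k = norm ((f ^^ k) x)" for k
  have "(\<Sum>k<n. a k) \<le> 2 * (\<Sum>k<N. a k)" for n
  proof -
    \<comment> \<open>The sum is lengthened by \<open>N\<close> nonnegative terms so that cutting it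
      at \<open>N\<close> leaves exactly \<open>n\<close> shifted terms.\<close>
    have "(\<Sum>k<n. a k) \<le> (\<Sum>k<N + n. a k)"
      by (intro sum_mono2) (auto simp: a_def)
    also have "\<dots> = (\<Sum>k<N. a k) + (\<Sum>k<n. a (N + k))"
      by (induction n) auto
    also have "(\<Sum>k<n. a (N + k)) \<le> (\<Sum>k<n. a k / 2)"
      unfolding a_def funpow_add comp_def by (intro sum_mono N)
    finally show ?thesis
      by (simp add: sum_divide_distrib[symmetric])
  qed
  then have "summable a"
    by (intro summableI_nonneg_bounded) (auto simp: a_def)
  then show ?thesis by (simp add: a_def[abs_def])
qed

section \<open>Symmetric bilinear forms and matrices\<close>

lemma bilinear_symmetricI:
  assumes "\<And>y. linear (\<lambda>x. b x y)" and "\<And>x y. b x y = b y x"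
  shows "bilinear b"
proof -
  have "linear (b x)" for x
    using assms(1)[of x] by (simp add: assms(2)[of _ x])
  with assms(1) show ?thesis by (simp add: bilinear_def)
qed

lemma symmetric_matrix_of_bilinear:
  fixes b :: "real^'n \<Rightarrow> real^'n \<Rightarrow> real"
  assumes "bilinear b" and sym: "\<And>x y. b x y = b y x"
  obtains H where "transpose H = H" and "\<And>x y. b x y = x \<bullet> (H *v y)"
proof
  define H where "H = (\<chi> i j. b (axis i 1) (axis j 1))"
  show "transpose H = H"
    by (simp add: H_def transpose_def sym)
  show "b x y = x \<bullet> (H *v y)" for x y
  proof -
    have "b x y = b (\<Sum>i\<in>UNIV. x $ i *s axis i 1) (\<Sum>j\<in>UNIV. y $ j *s axis j 1)"
      by (simp add: basis_expansion)
    also have "\<dots> = (\<Sum>i\<in>UNIV. \<Sum>j\<in>UNIV. x $ i * (y $ j * H $ i $ j))"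
      by (subst bilinear_sum[OF assms(1)])
         (simp add: sum.cartesian_product scalar_mult_eq_scaleR bilinear_lmul[OF assms(1)]
           bilinear_rmul[OF assms(1)] H_def mult_ac)
    also have "\<dots> = x \<bullet> (H *v y)"
      by (simp add: inner_vec_def matrix_vector_mult_def sum_distrib_left mult_ac)
    finally show ?thesis .
  qed
qed

lemma matrix_vector_mult_minus_right:
  fixes M :: "real^'n^'m"
  shows "M *v (- x) = - (M *v x)"
  by (rule linear_neg[OF matrix_vector_mul_linear])

lemma inner_symmetric_matrix:
  fixes H :: "real^'n^'n"
  assumes "transpose H = H"
  shows "x \<bullet> (H *v y) = y \<bullet> (H *v x)"
  by (metis assms dot_lmul_matrix inner_commute transpose_matrix_vector)

lemma symmetric_matrix_polarization:
  fixes H :: "real^'n^'n"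
  assumes "transpose H = H"
  shows "4 * (x \<bullet> (H *v y)) = (x + y) \<bullet> (H *v (x + y)) - (x - y) \<bullet> (H *v (x - y))"
  using inner_symmetric_matrix[OF assms, of x y]
  by (simp add: matrix_vector_right_distrib matrix_vector_mult_diff_distrib algebra_simps)

text \<open>Polarization recovers the whole bilinear form from its diagonal. This supplies the
  uniqueness needed by the \<open>THE\<close> in \<open>q_matrix\<close>.\<close>

lemma symmetric_matrix_eqI:
  fixes H G :: "real^'n^'n"
  assumes "transpose H = H" "transpose G = G" and eq: "\<And>x. x \<bullet> (H *v x) = x \<bullet> (G *v x)"
  shows "H = G"
proof -
  have "x \<bullet> (H *v y) = x \<bullet> (G *v y)" for x y
    using symmetric_matrix_polarization[OF assms(1), of x y]
      symmetric_matrix_polarization[OF assms(2), of x y] by (simp add: eq)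
  then have "H *v y = G *v y" for y
    using vector_eq_rdot by (metis inner_commute)
  then show ?thesis by (simp add: matrix_eq)
qed

lemma invertible_pos_def:
  fixes G :: "real^'n^'n"
  assumes "\<And>u. u \<noteq> 0 \<Longrightarrow> u \<bullet> (G *v u) > 0"
  shows "invertible G"
proof -
  have "u = 0" if "G *v u = 0" for u
    using assms[of u] that by force
  then show ?thesis
    by (simp add: invertible_left_inverse matrix_left_invertible_ker)
qed

lemma matrix_inv_mult_vec:
  fixes G :: "real^'n^'n"
  assumes "invertible G"
  shows "G *v (matrix_inv G *v y) = y"
proof -
  have "G ** matrix_inv G = mat 1"
    using assms unfolding invertible_def matrix_inv_def by (rule someI2_ex) simp
  then show ?thesis by (simp add: matrix_vector_mul_assoc)
qed

section \<open>Stacked vectors\<close>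

lemma sum_UNIV_sum_type:
  fixes g :: "'a::finite + 'b::finite \<Rightarrow> 'c::comm_monoid_add"
  shows "(\<Sum>i\<in>UNIV. g i) = (\<Sum>a\<in>UNIV. g (Inl a)) + (\<Sum>b\<in>UNIV. g (Inr b))"
  using sum.Plus[of UNIV UNIV g] by (simp add: comp_def)

lemma stack_surj:
  fixes z :: "real^('n::finite + 'm::finite)"
  obtains x u where "z = stack x u"
proof
  show "z = stack (\<chi> a. z $ Inl a) (\<chi> b. z $ Inr b)"
    by (simp add: stack_def vec_eq_iff split: sum.split)
qed

text \<open>The vector is split into its state part and its input part; symmetry merges the two
  cross terms into the factor 2. The state block stays as a form in \<open>stack x 0\<close>, since
  for minimising over \<open>u\<close> it is only a constant.\<close>

lemma stack_quadratic_form: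
  fixes H :: "real^('n::finite + 'm::finite)^('n + 'm)"
  assumes sym: "transpose H = H"
  shows "stack x u \<bullet> (H *v stack x u) = stack x 0 \<bullet> (H *v stack x 0)
    + 2 * (u \<bullet> (transpose (block_xu H) *v x)) + u \<bullet> (block_uu H *v u)"
proof -
  have split: "stack x u = stack x 0 + stack 0 u"
    by (simp add: stack_def vec_eq_iff split: sum.split)
  have H_sym: "H $ Inr i $ Inl j = H $ Inl j $ Inr i" for i j
    by (subst sym[symmetric]) (simp add: transpose_def)
  have ux: "stack 0 u \<bullet> (H *v stack x 0) = u \<bullet> (transpose (block_xu H) *v x)"
    by (simp add: inner_vec_def matrix_vector_mult_def sum_UNIV_sum_type stack_def
        block_xu_def transpose_def H_sym)
  have uu: "stack 0 u \<bullet> (H *v stack 0 u) = u \<bullet> (block_uu H *v u)"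
    by (simp add: inner_vec_def matrix_vector_mult_def sum_UNIV_sum_type stack_def block_uu_def)
  show ?thesis
    unfolding split using inner_symmetric_matrix[OF sym, of "stack x 0" "stack 0 u"] ux uu
    by (simp add: matrix_vector_right_distrib inner_add_left inner_add_right)
qed

lemma transpose_block_uu: "transpose H = H \<Longrightarrow> transpose (block_uu H) = block_uu H"
  by (simp add: block_uu_def transpose_def vec_eq_iff)

section \<open>The Q-function of a stabilizing policy\<close>

lemma closed_loop_linear_policy:
  "closed_loop A B (linear_policy K) x k = ((\<lambda>x. (A - B ** K) *v x) ^^ k) x"
proof (induction k)
  case (Suc k)
  have "A *v y + B *v linear_policy K y = (A - B ** K) *v y" for y
    by (simp add: linear_policy_def matrix_vector_mult_diff_rdistrib matrix_vector_mul_assoc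
        matrix_vector_mult_minus_right)
  with Suc show ?case by simp
qed simp

text \<open>The quadratic value function is polarized term by term: the series is defined for pairs
  of initial states, so that linearity in one argument can be checked inside the sum.\<close>

lemma value_fun_bilinear:
  fixes A :: "real^'n^'n" and B :: "real^'m^'n"
  assumes "stabilizing A B K" and Q: "sym_pos_def Q" and R: "sym_pos_def R"
    and \<gamma>: "0 < \<gamma>" "\<gamma> \<le> 1"
  obtains b where "bilinear b" "\<And>x y. b x y = b y x"
    "\<And>x. value_fun A B Q R \<gamma> (linear_policy K) x = b x x" "\<And>x. b x x \<ge> 0"
proof -
  define f where "f = (\<lambda>x. (A - B ** K) *v x)"
  define \<phi> where "\<phi> k = f ^^ k" for k
  \<comment> \<open>The cost per step under the policy as a form in the state alone; the two minus
    signs of the feedback cancel.\<close>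
  define W where "W = Q + transpose K ** R ** K"
  define t where "t x y k = \<gamma> ^ k * (\<phi> k x \<bullet> (W *v \<phi> k y))" for x y k
  have lin_f: "linear f"
    by (simp add: f_def)
  have vanish: "(\<lambda>k. (f ^^ k) x) \<longlonglongrightarrow> 0" for x
    using assms(1) by (simp add: stabilizing_def f_def)
  have K_adjoint: "x \<bullet> (transpose K *v v) = (K *v x) \<bullet> v" for x v
    by (metis dot_lmul_matrix inner_commute transpose_matrix_vector)
  have W_inner: "x \<bullet> (W *v y) = x \<bullet> (Q *v y) + (K *v x) \<bullet> (R *v (K *v y))" for x y
    unfolding W_def by (simp only: matrix_vector_mult_add_rdistrib inner_add_right K_adjoint
        matrix_vector_mul_assoc[symmetric])
  have "transpose Q = Q" "transpose R = R"
    using Q R by (auto simp: sym_pos_def_def)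
  then have W_sym: "x \<bullet> (W *v y) = y \<bullet> (W *v x)" for x y
    unfolding W_inner by (metis inner_symmetric_matrix)
  have nonneg: "x \<bullet> (Q *v x) \<ge> 0" "u \<bullet> (R *v u) \<ge> 0" for x u
    using Q R unfolding sym_pos_def_def
    by (metis inner_zero_left less_eq_real_def)+
  have lin_\<phi>: "linear (\<phi> k)" for k
    unfolding \<phi>_def by (rule linear_funpow[OF lin_f])
  have summ: "summable (t x y)" for x y
  proof -
    have sx: "summable (\<lambda>k. norm (\<phi> k x))"
      unfolding \<phi>_def by (rule summable_norm_vanishing_orbit[OF lin_f vanish])
    have "Bseq (\<lambda>k. \<phi> k y)"
      using vanish unfolding \<phi>_def by (meson convergentI convergent_imp_Bseq)
    then obtain D where D: "\<And>k. norm (\<phi> k y) \<le> D"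
      by (auto simp: Bseq_def)
    obtain C where C: "C > 0" "\<And>v. norm (W *v v) \<le> norm v * C"
      using bounded_linear.pos_bounded[OF matrix_vector_mul_bounded_linear[of W]] by blast
    \<comment> \<open>One orbit is summable and the other merely bounded, which suffices for the
      products; the discount factor is estimated by 1.\<close>
    have "norm (t x y k) \<le> norm (\<phi> k x) * (D * C)" for k
    proof -
      have "norm (t x y k) \<le> 1 * (norm (\<phi> k x) * norm (W *v \<phi> k y))"
        unfolding t_def real_norm_def abs_mult using \<gamma>
        by (intro mult_mono Cauchy_Schwarz_ineq2) (auto intro: power_le_one)
      also have "\<dots> \<le> norm (\<phi> k x) * (norm (\<phi> k y) * C)"
        using C(2) by (simp add: mult_left_mono)
      also have "\<dots> \<le> norm (\<phi> k x) * (D * C)"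
        using D C(1) by (intro mult_left_mono mult_right_mono) auto
      finally show ?thesis .
    qed
    then show ?thesis
      by (rule summable_comparison_test'[OF summable_mult2[OF sx], where N = 0])
  qed
  define b where "b x y = (\<Sum>k. t x y k)" for x y
  have sym: "b x y = b y x" for x y
    by (simp add: b_def t_def W_sym)
  have "linear (\<lambda>x. b x y)" for y
  proof (rule linearI)
    show "b (x + x') y = b x y + b x' y" for x x'
      unfolding b_def suminf_add[OF summ summ] t_def linear_add[OF lin_\<phi>] inner_add_left
      by (simp only: distrib_left)
    show "b (c *\<^sub>R x) y = c *\<^sub>R b x y" for c x
      unfolding b_def real_scaleR_def suminf_mult[OF summ, symmetric] t_def linear_scale[OF lin_\<phi>]
      by (simp add: mult_ac)
  qed
  then have "bilinear b"
    using sym by (rule bilinear_symmetricI)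
  moreover have "value_fun A B Q R \<gamma> (linear_policy K) x = b x x" for x
    unfolding value_fun_def b_def t_def \<phi>_def f_def W_inner closed_loop_linear_policy
    by (simp add: local_cost_def linear_policy_def matrix_vector_mult_minus_right)
  moreover have "b x x \<ge> 0" for x
    unfolding b_def using \<gamma> by (intro suminf_nonneg summ) (auto simp: t_def W_inner nonneg)
  ultimately show thesis using sym that by blast
qed

text \<open>The forms of \<open>Q\<close>, \<open>R\<close> and the value function are pulled back
  to stacked vectors along the linear maps \<open>X\<close>, \<open>U\<close> (the two components)
  and \<open>F\<close> (the successor state). Their weighted sum \<open>\<beta>\<close> is again
  symmetric and bilinear, hence given by a matrix.\<close>

lemma q_fun_matrix:
  fixes A :: "real^'n^'n" and B :: "real^'m^'n"
  assumes "stabilizing A B K" "sym_pos_def Q" "sym_pos_def R" "0 < \<gamma>" "\<gamma> \<le> 1"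
  obtains H where "transpose H = H"
    "\<And>x u. q_fun A B Q R \<gamma> (linear_policy K) x u = stack x u \<bullet> (H *v stack x u)"
proof -
  obtain b where b: "bilinear b" "\<And>x y. b x y = b y x"
    "\<And>x. value_fun A B Q R \<gamma> (linear_policy K) x = b x x"
    using value_fun_bilinear[OF assms] by metis
  obtain P where P: "transpose P = P" "\<And>x y. b x y = x \<bullet> (P *v y)"
    using symmetric_matrix_of_bilinear[OF b(1,2)] by metis
  define X :: "real^('n + 'm) \<Rightarrow> real^'n" where "X z = (\<chi> a. z $ Inl a)" for z
  define U :: "real^('n + 'm) \<Rightarrow> real^'m" where "U z = (\<chi> c. z $ Inr c)" for z
  define F where "F z = A *v X z + B *v U z" for z
  define \<beta> where "\<beta> z w = X z \<bullet> (Q *v X w) + U z \<bullet> (R *v U w) + \<gamma> * (F z \<bullet> (P *v F w))" for z w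
  have lin: "linear X" "linear U"
    by (auto simp: X_def U_def vec_eq_iff intro!: linearI)
  have lin_F: "linear F"
    by (rule linearI) (simp_all add: F_def linear_add[OF lin(1)] linear_add[OF lin(2)]
        linear_scale[OF lin(1)] linear_scale[OF lin(2)] matrix_vector_right_distrib
        matrix_vector_mult_scaleR scaleR_add_right)
  have "linear (\<lambda>z. \<beta> z w)" for w
    by (rule linearI) (simp_all add: \<beta>_def linear_add[OF lin(1)] linear_add[OF lin(2)]
        linear_scale[OF lin(1)] linear_scale[OF lin(2)] linear_add[OF lin_F] linear_scale[OF lin_F]
        inner_add_left algebra_simps)
  moreover have sym: "\<beta> z w = \<beta> w z" for z w
    unfolding \<beta>_def using assms(2,3) P(1) by (metis inner_symmetric_matrix sym_pos_def_def)
  ultimately have "bilinear \<beta>" by (rule bilinear_symmetricI)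
  from symmetric_matrix_of_bilinear[OF this sym]
  obtain H where H: "transpose H = H" "\<And>z w. \<beta> z w = z \<bullet> (H *v w)" by metis
  have "X (stack x u) = x" "U (stack x u) = u" for x u
    by (simp_all add: X_def U_def stack_def vec_eq_iff)
  then have "q_fun A B Q R \<gamma> (linear_policy K) x u = stack x u \<bullet> (H *v stack x u)" for x u
    by (simp add: H(2)[symmetric] \<beta>_def F_def q_fun_def local_cost_def b(3) P(2))
  with H(1) show thesis by (rule that)
qed

text \<open>The definite description yields its properties only after existence and uniqueness. For
  the latter, every vector is a stack, so two candidates have the same quadratic form
  everywhere.\<close>

lemma q_matrix_props:
  fixes A :: "real^'n^'n" and B :: "real^'m^'n"
  assumes "stabilizing A B K" "sym_pos_def Q" "sym_pos_def R" "0 < \<gamma>" "\<gamma> \<le> 1"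
  defines "H \<equiv> q_matrix A B Q R \<gamma> (linear_policy K)"
  shows "transpose H = H"
    and "q_fun A B Q R \<gamma> (linear_policy K) x u = stack x u \<bullet> (H *v stack x u)"
proof -
  let ?P = "\<lambda>H. transpose H = H \<and>
    (\<forall>x u. q_fun A B Q R \<gamma> (linear_policy K) x u = stack x u \<bullet> (H *v stack x u))"
  obtain G where G: "?P G"
    using q_fun_matrix[OF assms(1-5)] by metis
  have "H' = G" if "?P H'" for H'
  proof (rule symmetric_matrix_eqI)
    show "z \<bullet> (H' *v z) = z \<bullet> (G *v z)" for z
    proof -
      obtain x u where z: "z = stack x u"
        by (rule stack_surj)
      show ?thesis
        unfolding z using that G by metis
    qed
  qed (use that G in auto)
  with G have "?P H"
    unfolding H_def q_matrix_def by (rule theI)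
  then show "transpose H = H"
    and "q_fun A B Q R \<gamma> (linear_policy K) x u = stack x u \<bullet> (H *v stack x u)"
    by auto
qed

section \<open>Minimisation over the input\<close>

lemma is_arg_min_quadratic:
  fixes G :: "real^'m^'m"
  assumes sym: "transpose G = G" and pos: "\<And>u. u \<noteq> 0 \<Longrightarrow> u \<bullet> (G *v u) > 0"
    and q: "\<And>u. q u = c + 2 * (u \<bullet> y) + u \<bullet> (G *v u)"
  shows "is_arg_min q (\<lambda>_. True) v \<longleftrightarrow> v = - (matrix_inv G *v y)"
proof -
  define w where "w = - (matrix_inv G *v y)"
  \<comment> \<open>The stationarity condition, which removes the linear term when \<open>q\<close>
    is expanded around \<open>w\<close>.\<close>
  have Gw: "G *v w = - y"
    by (simp add: w_def matrix_vector_mult_minus_right matrix_inv_mult_vec invertible_pos_def pos)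
  have square: "q u = q w + (u - w) \<bullet> (G *v (u - w))" for u
    using inner_symmetric_matrix[OF sym, of w u] Gw
    by (simp add: q matrix_vector_mult_diff_distrib algebra_simps inner_diff_left inner_diff_right)
  have lt: "q w < q u" if "u \<noteq> w" for u
    using square[of u] pos[of "u - w"] that by simp
  show ?thesis
    unfolding is_arg_min_def w_def[symmetric] using lt by (metis less_asym)
qed

text \<open>The equivalence expresses both existence and uniqueness of the minimiser. Invertibility
  is asserted separately because \<open>matrix_inv\<close> is a choice term that would be
  unspecified on a singular matrix.\<close>

theorem lemma2:
  fixes A :: "real^'n^'n" and B :: "real^'m^'n"
    and Q :: "real^'n^'n" and R :: "real^'m^'m"
    and K :: "real^'n^'m" and \<gamma> :: real
    and H :: "real^('n + 'm)^('n + 'm)"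
  assumes "controllable A B"
    and "sym_pos_def Q" and "sym_pos_def R"
    and "0 < \<gamma>" and "\<gamma> \<le> 1"
    and "stabilizing A B K"
    and H: "H = q_matrix A B Q R \<gamma> (linear_policy K)"
  shows "invertible (block_uu H) \<and>
    (\<forall>\<pi>'. is_policy_improvement A B Q R \<gamma> (linear_policy K) \<pi>' \<longleftrightarrow>
       (\<forall>x. \<pi>' x = - ((matrix_inv (block_uu H) ** transpose (block_xu H)) *v x)))"
proof -
  let ?q = "q_fun A B Q R \<gamma> (linear_policy K)"
  note props = q_matrix_props[OF assms(6,2-5), folded H]
  have q: "?q x u = stack x 0 \<bullet> (H *v stack x 0)
      + 2 * (u \<bullet> (transpose (block_xu H) *v x)) + u \<bullet> (block_uu H *v u)" for x u
    unfolding props(2) by (rule stack_quadratic_form[OF props(1)])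
  have pos: "u \<bullet> (block_uu H *v u) > 0" if "u \<noteq> 0" for u
  proof -
    \<comment> \<open>At state 0 the Q-function reduces to the form of \<open>block_uu H\<close>. It
      also equals the input cost plus a discounted nonnegative value, so \<open>block_uu H\<close>
      dominates \<open>R\<close>.\<close>
    have "value_fun A B Q R \<gamma> (linear_policy K) x \<ge> 0" for x
      using value_fun_bilinear[OF assms(6,2-5)] by metis
    then have "?q 0 u \<ge> u \<bullet> (R *v u)"
      using assms(4) by (simp add: q_fun_def local_cost_def)
    moreover have "stack 0 0 = (0 :: real^('n + 'm))"
      by (simp add: stack_def vec_eq_iff split: sum.split)
    ultimately have "u \<bullet> (R *v u) \<le> u \<bullet> (block_uu H *v u)"
      by (simp add: q)
    moreover have "u \<bullet> (R *v u) > 0"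
      using assms(3) that by (simp add: sym_pos_def_def)
    ultimately show ?thesis by linarith
  qed
  have "is_arg_min (?q x) (\<lambda>_. True) v \<longleftrightarrow>
      v = - ((matrix_inv (block_uu H) ** transpose (block_xu H)) *v x)" for x v
    using is_arg_min_quadratic[OF transpose_block_uu[OF props(1)] pos q, of x v]
    unfolding matrix_vector_mul_assoc .
  then show ?thesis
    unfolding is_policy_improvement_def using invertible_pos_def[OF pos] by simp
qed

end
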